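(* If every prime element of $\mathcal{O}_K$ is $\mathcal{H}$-suitable, then $\mathcal{H}$ is a principal ideal domain (every left ideal $\mathcal{I}$ of $\mathcal{H}$ is of the form $\mathcal{H}D$ for some $D\in\mathcal{H}$).
   Context: Let $K$ be a totally real number field of degree $n$ over $\mathbb{Q}$ with real embeddings $\sigma_1,\dots,\sigma_n$ and ring of integers $\mathcal{O}_K$ a unique factorization domain; regard $K\subset\mathbb{R}$ via $\sigma_1$. $N_{K/\mathbb{Q}}(\lambda)=\sigma_1(\lambda)\cdots\sigma_n(\lambda)$; $\lambda$ is totally positive if all $\sigma_t(\lambda)>0$. Let $i,j,k$ be the real quaternion units with $i^2=j^2=k^2=ijk=-1$; for $L=x+yi+zj+wk$ put $\overline{L}=x-yi-zj-wk$ and $N(L)=L\overline{L}$. Fix $A,B,\mu,\nu\in\mathcal{O}_K$ such that $S=4A-\mu^2$ and $T=BS-\nu^2$ are totally positive; put $\alpha=\frac{\mu+i\sqrt{S}}{2}$, $\beta=\frac{\nu i+j\sqrt{T}}{\sqrt{S}}$, and $\mathcal{H}=\{x+y\alpha+z\beta+w\alpha\beta : x,y,z,w\in\mathcal{O}_K\}$ (a ring; norms of its elements lie in $\mathcal{O}_K$). The double norm is $\mathcal{N}=N_{K/\mathbb{Q}}\circ N$. For $L\in\mathcal{H}$, "$\rho\mid L$" means $L\in\rho\mathcal{H}$. A prime element $\rho\in\mathcal{O}_K$ is $\mathcal{H}$-suitable if for every $L\in\mathcal{H}$ with $\rho\nmid L$, the set $\mathcal{H}\frac{L}{\rho}+\mathcal{H}$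 contains a nonzero element $L'$ with $\mathcal{N}(L')<1$. *)

theory Defs
  imports Complex_Main "HOL-Library.FuncSet" "HOL-Algebra.Algebraic_Closure_Type"
begin

datatype quat = Quat (qRe: real) (qI: real) (qJ: real) (qK: real)

lemma quat_eq_iff: "x = y \<longleftrightarrow> qRe x = qRe y \<and> qI x = qI y \<and> qJ x = qJ y \<and> qK x = qK y"
  by (cases x; cases y) simp

instantiation quat :: real_algebra_1
begin

definition "0 = Quat 0 0 0 0"
definition "1 = Quat 1 0 0 0"
definition "x + y = Quat (qRe x + qRe y) (qI x + qI y) (qJ x + qJ y) (qK x + qK y)"
definition "- x = Quat (- qRe x) (- qI x) (- qJ x) (- qK x)"
definition "x - y = Quat (qRe x - qRe y) (qI x - qI y) (qJ x - qJ y) (qK x - qK y)"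
definition "r *\<^sub>R x = Quat (r * qRe x) (r * qI x) (r * qJ x) (r * qK x)"
definition "x * y = Quat
  (qRe x * qRe y - qI x * qI y - qJ x * qJ y - qK x * qK y)
  (qRe x * qI y + qI x * qRe y + qJ x * qK y - qK x * qJ y)
  (qRe x * qJ y - qI x * qK y + qJ x * qRe y + qK x * qI y)
  (qRe x * qK y + qI x * qJ y - qJ x * qI y + qK x * qRe y)"

instance
  by standard
    (auto simp: zero_quat_def one_quat_def plus_quat_def uminus_quat_def minus_quat_def
       scaleR_quat_def times_quat_def algebra_simps)

end

definition quat_i :: quat where "quat_i = Quat 0 1 0 0"
definition quat_j :: quat where "quat_j = Quat 0 0 1 0"
definition quat_k :: quat where "quat_k = Quat 0 0 0 1"

lemma quat_unit_relations:
  "quat_i * quat_i = - 1" "quat_j * quat_j = - 1" "quat_k * quat_k = - 1"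
  "quat_i * quat_j * quat_k = - 1"
  by (simp_all add: quat_i_def quat_j_def quat_k_def times_quat_def uminus_quat_def one_quat_def)

lemma Quat_expand:
  "Quat x y z w = of_real x + y *\<^sub>R quat_i + z *\<^sub>R quat_j + w *\<^sub>R quat_k"
  by (simp add: of_real_def quat_i_def quat_j_def quat_k_def plus_quat_def scaleR_quat_def
      one_quat_def)

definition qcnj :: "quat \<Rightarrow> quat" where
  "qcnj L = Quat (qRe L) (- qI L) (- qJ L) (- qK L)"

definition qnorm :: "quat \<Rightarrow> real" where
  "qnorm L = qRe (L * qcnj L)"

lemma of_real_qnorm: "of_real (qnorm L) = L * qcnj L"
  by (simp add: qnorm_def qcnj_def of_real_def times_quat_def scaleR_quat_def one_quat_def)

abbreviation subring_of :: "'a::ring_1 set \<Rightarrow> 'a ring" where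
  "subring_of S \<equiv> ring_of_type_algebra\<lparr>carrier := S\<rparr>"

definition number_field :: "nat \<Rightarrow> real set \<Rightarrow> bool" where
  "number_field n K \<longleftrightarrow> subfield K ring_of_type_algebra \<and>
     ring.dimension ring_of_type_algebra n \<rat> K"

definition totally_real :: "real set \<Rightarrow> bool" where
  "totally_real K \<longleftrightarrow>
     (\<forall>\<phi> \<in> ring_hom (subring_of K) (ring_of_type_algebra :: complex ring). \<phi> ` K \<subseteq> \<real>)"

text \<open>Embeddings are taken in \<^const>\<open>extensional\<close>, so that different functions in this set
  are different embeddings of \<open>K\<close>.\<close>

definition real_embeddings :: "real set \<Rightarrow> (real \<Rightarrow> real) set" where
  "real_embeddings K =
     ring_hom (subring_of K) (ring_of_type_algebra :: real ring) \<inter> extensional K"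

definition ring_of_integers :: "real set \<Rightarrow> real set" where
  "ring_of_integers K = {x \<in> K. algebraic_int x}"

definition field_norm :: "nat \<Rightarrow> (nat \<Rightarrow> real \<Rightarrow> real) \<Rightarrow> real \<Rightarrow> real" where
  "field_norm n \<sigma> x = (\<Prod>t=1..n. \<sigma> t x)"

definition totally_positive :: "nat \<Rightarrow> (nat \<Rightarrow> real \<Rightarrow> real) \<Rightarrow> real \<Rightarrow> bool" where
  "totally_positive n \<sigma> x \<longleftrightarrow> (\<forall>t\<in>{1..n}. \<sigma> t x > 0)"

definition disc_S :: "real \<Rightarrow> real \<Rightarrow> real" where
  "disc_S A \<mu> = 4 * A - \<mu>\<^sup>2"

definition disc_T :: "real \<Rightarrow> real \<Rightarrow> real \<Rightarrow> real \<Rightarrow> real" where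
  "disc_T A B \<mu> \<nu> = B * disc_S A \<mu> - \<nu>\<^sup>2"

definition quat_alpha :: "real \<Rightarrow> real \<Rightarrow> quat" where
  "quat_alpha A \<mu> = (of_real \<mu> + sqrt (disc_S A \<mu>) *\<^sub>R quat_i) /\<^sub>R 2"

definition quat_beta :: "real \<Rightarrow> real \<Rightarrow> real \<Rightarrow> real \<Rightarrow> quat" where
  "quat_beta A B \<mu> \<nu> =
     (\<nu> *\<^sub>R quat_i + sqrt (disc_T A B \<mu> \<nu>) *\<^sub>R quat_j) /\<^sub>R sqrt (disc_S A \<mu>)"

definition quat_order :: "real set \<Rightarrow> real \<Rightarrow> real \<Rightarrow> real \<Rightarrow> real \<Rightarrow> quat set" where
  "quat_order K A B \<mu> \<nu> =
     {of_real x + y *\<^sub>R quat_alpha A \<mu> + z *\<^sub>R quat_beta A B \<mu> \<nu>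
        + w *\<^sub>R (quat_alpha A \<mu> * quat_beta A B \<mu> \<nu>) | x y z w.
      x \<in> ring_of_integers K \<and> y \<in> ring_of_integers K \<and>
      z \<in> ring_of_integers K \<and> w \<in> ring_of_integers K}"

definition double_norm :: "nat \<Rightarrow> (nat \<Rightarrow> real \<Rightarrow> real) \<Rightarrow> quat \<Rightarrow> real" where
  "double_norm n \<sigma> L = field_norm n \<sigma> (qnorm L)"

definition suitable :: "nat \<Rightarrow> (nat \<Rightarrow> real \<Rightarrow> real) \<Rightarrow> quat set \<Rightarrow> real \<Rightarrow> bool" where
  "suitable n \<sigma> H \<rho> \<longleftrightarrow>
     (\<forall>L\<in>H. L \<notin> {\<rho> *\<^sub>R M | M. M \<in> H} \<longrightarrow>
        (\<exists>L' \<in> {P * (L /\<^sub>R \<rho>) + Q | P Q. P \<in> H \<and> Q \<in> H}.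
           L' \<noteq> 0 \<and> double_norm n \<sigma> L' < 1))"

definition left_ideal :: "'a set \<Rightarrow> 'a ring \<Rightarrow> bool" where
  "left_ideal I R \<longleftrightarrow> additive_subgroup I R \<and>
     (\<forall>a\<in>carrier R. \<forall>x\<in>I. a \<otimes>\<^bsub>R\<^esub> x \<in> I)"

text \<open>The library's \<^const>\<open>domain\<close> and \<^const>\<open>principal_domain\<close> are commutative.
  \<^const>\<open>cgenideal\<close> is the left ideal of left multiples of its generator.\<close>

definition left_principal_ideal_domain :: "'a ring \<Rightarrow> bool" where
  "left_principal_ideal_domain R \<longleftrightarrow>
     ring R \<and> \<one>\<^bsub>R\<^esub> \<noteq> \<zero>\<^bsub>R\<^esub> \<and>
     (\<forall>a\<in>carrier R. \<forall>b\<in>carrier R. a \<otimes>\<^bsub>R\<^esub> b = \<zero>\<^bsub>R\<^esub> \<longrightarrow> a = \<zero>\<^bsub>R\<^esub> \<or> b = \<zero>\<^bsub>R\<^esub>) \<and>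
     (\<forall>I. left_ideal I R \<longrightarrow> (\<exists>D\<in>carrier R. I = PIdl\<^bsub>R\<^esub> D))"

end

theory Submission
  imports Defs "Jordan_Normal_Form.Char_Poly"
begin

text \<open>Let \<open>D\<close> be a nonzero element of least double norm in a left ideal \<open>I\<close>, let \<open>M \<in> I\<close> and
  \<open>Y = M D\<^sup>-\<^sup>1\<close>. The norm of \<open>D\<close> is a denominator of \<open>Y\<close>; if \<open>Y \<notin> \<H>\<close>, stripping prime factors off
  this denominator gives a prime \<open>\<rho>\<close> and an integer \<open>e\<close> with \<open>\<rho> e Y \<in> \<H>\<close> but \<open>e Y \<notin> \<H>\<close>. Suitability
  of \<open>\<rho>\<close> yields \<open>P e Y + Q \<noteq> 0\<close> of double norm less than 1, and then \<open>(P e Y + Q) D \<in> I\<close> contradicts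
  the choice of \<open>D\<close>.

  A least double norm exists because field norms of algebraic integers are integers: they are
  algebraic integers as products of conjugates, and rational because the product of the conjugates
  of \<open>x\<close> is the determinant of multiplication by \<open>x\<close> over \<open>\<rat>\<close>, the matrix of conjugates of a basis
  being invertible by Dedekind's independence of characters. Double norms are positive because a
  conjugate of the norm of a quaternion is the norm of a quaternion with conjugate coordinates and
  parameters.\<close>

subsection \<open>Subrings and subfields of a type\<close>

lemma ring_of_type_algebra_simps [simp]:
  "carrier ring_of_type_algebra = UNIV"
  "x \<otimes>\<^bsub>ring_of_type_algebra\<^esub> y = x * y" "x \<oplus>\<^bsub>ring_of_type_algebra\<^esub> y = x + y"
  "\<one>\<^bsub>ring_of_type_algebra\<^esub> = 1" "\<zero>\<^bsub>ring_of_type_algebra\<^esub> = 0"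
  by (simp_all add: ring_of_type_algebra_def)

lemma ring_ring_of_type_algebra: "ring (ring_of_type_algebra :: 'a::ring_1 ring)"
proof (rule ringI)
  show "abelian_group (ring_of_type_algebra :: 'a ring)"
    by (rule abelian_groupI) (auto simp: add_ac intro: exI[of _ "- _"])
  show "Group.monoid (ring_of_type_algebra :: 'a ring)"
    by (rule monoidI) (auto simp: mult.assoc)
qed (auto simp: distrib_left distrib_right)

lemma a_inv_ring_of_type_algebra [simp]: "\<ominus>\<^bsub>ring_of_type_algebra\<^esub> x = - (x :: 'a::ring_1)"
  using ring.is_abelian_group[OF ring_ring_of_type_algebra]
  by (rule abelian_group.minus_equality) simp_all

lemma m_inv_ring_of_type_algebra [simp]:
  assumes "x \<noteq> 0"
  shows "inv\<^bsub>ring_of_type_algebra\<^esub> x = inverse (x :: 'a::field)"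
  using comm_monoid.comm_inv_char[of "ring_of_type_algebra :: 'a ring" x "inverse x"] assms
    cring.axioms(2)[OF cring_from_type_algebra] by simp

lemma subring_ring_of_type_algebra_iff:
  "subring S (ring_of_type_algebra :: 'a::ring_1 ring) \<longleftrightarrow>
     0 \<in> S \<and> 1 \<in> S \<and> (\<forall>x\<in>S. - x \<in> S) \<and> (\<forall>x\<in>S. \<forall>y\<in>S. x + y \<in> S) \<and> (\<forall>x\<in>S. \<forall>y\<in>S. x * y \<in> S)"
proof
  assume S: "subring S (ring_of_type_algebra :: 'a ring)"
  show "0 \<in> S \<and> 1 \<in> S \<and> (\<forall>x\<in>S. - x \<in> S) \<and> (\<forall>x\<in>S. \<forall>y\<in>S. x + y \<in> S) \<and> (\<forall>x\<in>S. \<forall>y\<in>S. x * y \<in> S)"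
    using subringE(2,3,5-7)[OF S] by simp
qed (auto intro!: ring.subringI[OF ring_ring_of_type_algebra])

lemma subfield_ring_of_type_algebra_iff:
  "subfield K (ring_of_type_algebra :: 'a::field ring) \<longleftrightarrow>
     subring K (ring_of_type_algebra :: 'a ring) \<and> (\<forall>x\<in>K. inverse x \<in> K)"
proof
  assume K: "subfield K (ring_of_type_algebra :: 'a ring)"
  have "inverse x \<in> K" if "x \<in> K" for x
    using ring.subfield_m_inv(1)[OF ring_ring_of_type_algebra K, of x] that by (cases "x = 0") auto
  then show "subring K ring_of_type_algebra \<and> (\<forall>x\<in>K. inverse x \<in> K)"
    using subfieldE(1)[OF K] by blast
next
  assume "subring K (ring_of_type_algebra :: 'a ring) \<and> (\<forall>x\<in>K. inverse x \<in> K)"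
  then show "subfield K (ring_of_type_algebra :: 'a ring)"
    by (intro field.subfieldI'[OF field_from_type_algebra]) simp_all
qed

lemma subfield_Rats: "subfield \<rat> (ring_of_type_algebra :: 'a::field_char_0 ring)"
  by (simp add: subfield_ring_of_type_algebra_iff subring_ring_of_type_algebra_iff)

locale type_subfield =
  fixes K :: "'a::field_char_0 set"
  assumes subfield: "subfield K ring_of_type_algebra"
begin

lemma subring: "subring K ring_of_type_algebra"
  using subfield subfield_ring_of_type_algebra_iff by blast

lemma zero_mem: "0 \<in> K" and one_mem: "1 \<in> K"
  and uminus_mem: "x \<in> K \<Longrightarrow> - x \<in> K"
  and add_mem: "x \<in> K \<Longrightarrow> y \<in> K \<Longrightarrow> x + y \<in> K"
  and mult_mem: "x \<in> K \<Longrightarrow> y \<in> K \<Longrightarrow> x * y \<in> K"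
  using subring unfolding subring_ring_of_type_algebra_iff by blast+

lemma inverse_mem: "x \<in> K \<Longrightarrow> inverse x \<in> K"
  using subfield subfield_ring_of_type_algebra_iff by blast

lemma diff_mem: "x \<in> K \<Longrightarrow> y \<in> K \<Longrightarrow> x - y \<in> K"
  using add_mem[of x "- y"] uminus_mem by simp

lemma power_mem: "x \<in> K \<Longrightarrow> x ^ k \<in> K"
  by (induction k) (auto intro: one_mem mult_mem)

lemma sum_mem: "(\<And>i. i \<in> S \<Longrightarrow> f i \<in> K) \<Longrightarrow> sum f S \<in> K"
  by (induction S rule: infinite_finite_induct) (auto intro: zero_mem add_mem)

lemma of_nat_mem: "of_nat k \<in> K"
  by (induction k) (auto intro: zero_mem one_mem add_mem)

lemma of_int_mem: "of_int m \<in> K"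
  by (cases m rule: int_cases2) (auto intro: of_nat_mem uminus_mem)

lemma of_rat_mem: "of_rat q \<in> K"
  by (cases q) (auto simp: of_rat_rat divide_inverse intro: of_int_mem inverse_mem mult_mem)

end

locale subfield_embedding = type_subfield K for K :: "'a::field_char_0 set" +
  fixes f :: "'a \<Rightarrow> 'b::field_char_0"
  assumes hom: "f \<in> Ring.ring_hom (subring_of K) ring_of_type_algebra"
begin

lemma hom_one: "f 1 = 1"
  using ring_hom_one[OF hom] by simp

lemma hom_mult: "x \<in> K \<Longrightarrow> y \<in> K \<Longrightarrow> f (x * y) = f x * f y"
  using ring_hom_mult[OF hom, of x y] by simp

lemma hom_add: "x \<in> K \<Longrightarrow> y \<in> K \<Longrightarrow> f (x + y) = f x + f y"
  using ring_hom_add[OF hom, of x y] by simp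

lemma hom_zero: "f 0 = 0"
  using hom_add[of 0 0] zero_mem by simp

lemma hom_uminus: "x \<in> K \<Longrightarrow> f (- x) = - f x"
  using hom_add[of x "- x"] by (simp add: hom_zero uminus_mem eq_neg_iff_add_eq_0 add.commute)

lemma hom_diff: "x \<in> K \<Longrightarrow> y \<in> K \<Longrightarrow> f (x - y) = f x - f y"
  using hom_add[of x "- y"] by (simp add: hom_uminus uminus_mem)

lemma hom_power: "x \<in> K \<Longrightarrow> f (x ^ k) = f x ^ k"
  by (induction k) (simp_all add: hom_one hom_mult power_mem)

lemma hom_sum: "(\<And>i. i \<in> S \<Longrightarrow> g i \<in> K) \<Longrightarrow> f (sum g S) = (\<Sum>i\<in>S. f (g i))"
  by (induction S rule: infinite_finite_induct) (simp_all add: hom_zero hom_add sum_mem)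

lemma hom_of_nat: "f (of_nat k) = of_nat k"
  by (induction k) (simp_all add: hom_zero hom_one hom_add one_mem of_nat_mem)

lemma hom_of_int: "f (of_int m) = of_int m"
  by (cases m rule: int_cases2) (simp_all add: hom_of_nat hom_uminus of_nat_mem)

lemma hom_eq_0_iff: "x \<in> K \<Longrightarrow> f x = 0 \<longleftrightarrow> x = 0"
  using hom_mult[of x "inverse x"] by (cases "x = 0") (auto simp: hom_zero hom_one inverse_mem)

lemma hom_inverse: "x \<in> K \<Longrightarrow> f (inverse x) = inverse (f x)"
  using hom_mult[of x "inverse x"]
  by (cases "x = 0") (simp_all add: hom_zero hom_one inverse_mem inverse_unique)

lemma hom_of_rat: "f (of_rat q) = of_rat q"
  by (cases q)
    (simp add: of_rat_rat divide_inverse hom_mult hom_inverse hom_of_int of_int_mem inverse_mem)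

lemma algebraic_int_hom:
  assumes "x \<in> K" "algebraic_int x"
  shows "algebraic_int (f x)"
proof -
  obtain p :: "int poly" where p: "poly (map_poly of_int p) x = 0" "lead_coeff p = 1"
    using assms(2) by (auto simp: algebraic_int_altdef_ipoly)
  have "poly (map_poly of_int p) (f x) = (\<Sum>i\<le>degree p. of_int (coeff p i) * f x ^ i)"
    by (simp add: poly_altdef degree_map_poly coeff_map_poly)
  also have "\<dots> = f (\<Sum>i\<le>degree p. of_int (coeff p i) * x ^ i)"
    using assms(1)
    by (simp add: hom_sum hom_mult hom_power hom_of_int of_int_mem power_mem mult_mem)
  also have "\<dots> = f (poly (map_poly of_int p) x)"
    by (simp add: poly_altdef degree_map_poly coeff_map_poly)
  finally show ?thesis
    using p by (auto simp: algebraic_int_altdef_ipoly hom_zero)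
qed

end

subsection \<open>Sums and products of algebraic integers\<close>

interpretation int_module: Modules.module "\<lambda>(k :: int) (x :: 'a::ring_1). of_int k * x"
  by unfold_locales (simp_all add: algebra_simps)

abbreviation int_span :: "'a::ring_1 set \<Rightarrow> 'a set" where
  "int_span \<equiv> int_module.span"

lemma int_span_mult:
  fixes x y :: "'a::comm_ring_1"
  assumes "x \<in> int_span A" "y \<in> int_span B"
  shows "x * y \<in> int_span {a * b | a b. a \<in> A \<and> b \<in> B}"
proof -
  let ?C = "{a * b | a b. a \<in> A \<and> b \<in> B}"
  have left: "a * y \<in> int_span ?C" if "a \<in> A" for a
    using assms(2)
  proof (induction rule: int_module.span_induct_alt)
    case (step k b z)
    have "a * (of_int k * b + z) = of_int k * (a * b) + a * z"
      by (simp add: algebra_simps)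
    also have "\<dots> \<in> int_span ?C"
      using step that
      by (blast intro: int_module.span_add int_module.span_scale int_module.span_base)
    finally show ?case .
  qed (simp add: int_module.span_zero)
  show ?thesis
    using assms(1)
  proof (induction rule: int_module.span_induct_alt)
    case (step k a z)
    have "(of_int k * a + z) * y = of_int k * (a * y) + z * y"
      by (simp add: algebra_simps)
    also have "\<dots> \<in> int_span ?C"
      using step left by (blast intro: int_module.span_add int_module.span_scale)
    finally show ?case .
  qed (simp add: int_module.span_zero)
qed

definition int_span_stable :: "'a::ring_1 \<Rightarrow> 'a set \<Rightarrow> bool" where
  "int_span_stable x B \<longleftrightarrow> (\<forall>b\<in>B. x * b \<in> int_span B)"

lemma int_span_stable_mult:
  fixes x :: "'a::comm_ring_1"
  assumes "int_span_stable x B" "z \<in> int_span B"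
  shows "x * z \<in> int_span B"
proof -
  have "int_span {a * b | a b. a \<in> {x} \<and> b \<in> B} \<subseteq> int_span B"
    using assms(1) by (intro int_module.span_minimal) (auto simp: int_span_stable_def)
  then show ?thesis
    using int_span_mult[of x "{x}" z B] assms(2) int_module.span_base[of x "{x}"] by blast
qed

lemma int_span_stable_plus: "int_span_stable x B \<Longrightarrow> int_span_stable y B \<Longrightarrow> int_span_stable (x + y) B"
  by (simp add: int_span_stable_def distrib_right int_module.span_add)

lemma int_span_stable_times:
  fixes x y :: "'a::comm_ring_1"
  assumes "int_span_stable x B" "int_span_stable y B"
  shows "int_span_stable (x * y) B"
  using int_span_stable_mult[OF assms(1)] assms(2) by (simp add: int_span_stable_def mult.assoc)

lemma algebraic_int_if_int_matrix_eigenvalue: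
  fixes x :: "'a::field_char_0"
  assumes "M \<in> carrier_mat m m" "eigenvalue (map_mat of_int M) x"
  shows "algebraic_int x"
proof -
  have "poly (map_poly of_int (char_poly M)) x = 0"
    using assms eigenvalue_root_char_poly[of "map_mat of_int M" m x]
    by (simp add: of_int_hom.char_poly_hom[OF assms(1)])
  then show ?thesis
    using degree_monic_char_poly[OF assms(1)] by (auto simp: algebraic_int_altdef_ipoly)
qed

lemma algebraic_int_if_int_span_stable:
  fixes x :: "'a::field_char_0"
  assumes "finite B" "1 \<in> B" and stable: "int_span_stable x B"
  shows "algebraic_int x"
proof -
  obtain h where h: "bij_betw h {0..<card B} B"
    using ex_bij_betw_nat_finite[OF assms(1)] by blast
  have "\<exists>u. x * b = (\<Sum>b'\<in>B. of_int (u b') * b')" if "b \<in> B" for b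
    using stable that unfolding int_span_stable_def int_module.span_finite[OF assms(1)] by blast
  then obtain u where u: "\<And>b. b \<in> B \<Longrightarrow> x * b = (\<Sum>b'\<in>B. of_int (u b b') * b')"
    by metis
  define M where "M = mat (card B) (card B) (\<lambda>(i, j). u (h i) (h j))"
  define v where "v = vec (card B) h"
  have "map_mat of_int M *\<^sub>v v = x \<cdot>\<^sub>v v"
  proof (rule eq_vecI)
    fix i assume "i < dim_vec (x \<cdot>\<^sub>v v)"
    then have i: "i < card B" "h i \<in> B"
      using bij_betw_apply[OF h] by (simp_all add: v_def)
    have "(map_mat of_int M *\<^sub>v v) $ i = (\<Sum>j\<in>{0..<card B}. of_int (u (h i) (h j)) * h j)"
      using i by (simp add: M_def v_def scalar_prod_def)
    also have "\<dots> = (x \<cdot>\<^sub>v v) $ i"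
      using i by (simp add: u sum.reindex_bij_betw[OF h, of "\<lambda>b. of_int (u (h i) b) * b"] v_def)
    finally show "(map_mat of_int M *\<^sub>v v) $ i = (x \<cdot>\<^sub>v v) $ i" .
  qed (simp add: M_def v_def)
  moreover have "v \<noteq> 0\<^sub>v (card B)"
  proof
    assume "v = 0\<^sub>v (card B)"
    moreover obtain i where "i < card B" "h i = 1"
      using assms(2) bij_betw_imp_surj_on[OF h] by force
    ultimately show False
      by (metis v_def index_vec index_zero_vec(1) zero_neq_one)
  qed
  ultimately have "eigenvalue (map_mat of_int M) x"
    unfolding eigenvalue_def eigenvector_def by (intro exI[of _ v]) (simp add: M_def v_def)
  then show ?thesis
    by (rule algebraic_int_if_int_matrix_eigenvalue[where M = M and m = "card B", rotated])
      (simp add: M_def)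
qed

lemma algebraic_int_power_in_int_span:
  fixes x :: "'a::field_char_0"
  assumes "algebraic_int x"
  obtains d where "d > 0" "x ^ d \<in> int_span ((^) x ` {..<d})"
proof -
  obtain p :: "int poly" where p: "poly (map_poly of_int p) x = 0" "lead_coeff p = 1"
    using assms by (auto simp: algebraic_int_altdef_ipoly)
  have "degree p \<noteq> 0"
  proof
    assume "degree p = 0"
    then have "p = 1" using p(2) by (metis degree_0_id of_int_hom.hom_one one_pCons)
    then show False using p(1) by simp
  qed
  have "(\<Sum>i<degree p. of_int (coeff p i) * x ^ i) + x ^ degree p = 0"
    using p by (simp add: poly_altdef degree_map_poly coeff_map_poly flip: lessThan_Suc_atMost)
  then have power_degree: "x ^ degree p = - (\<Sum>i<degree p. of_int (coeff p i) * x ^ i)"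
    by (simp add: eq_neg_iff_add_eq_0 add.commute)
  have "x ^ degree p \<in> int_span ((^) x ` {..<degree p})"
    unfolding power_degree
    by (intro int_module.span_neg int_module.span_sum int_module.span_scale int_module.span_base)
      simp
  then show thesis
    using that \<open>degree p \<noteq> 0\<close> by blast
qed

lemma algebraic_int_obtains_int_span_stable:
  fixes x :: "'a::field_char_0"
  assumes "algebraic_int x"
  obtains B where "finite B" "1 \<in> B" "int_span_stable x B"
proof -
  obtain d where d: "d > 0" "x ^ d \<in> int_span ((^) x ` {..<d})"
    using assms by (rule algebraic_int_power_in_int_span)
  let ?B = "(^) x ` {..<d}"
  have "x ^ Suc i \<in> int_span ?B" if "i < d" for i
  proof (cases "Suc i = d")
    case False
    then show ?thesis
      using that by (intro int_module.span_base imageI) simp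
  qed (use d(2) in simp)
  then have "int_span_stable x ?B"
    by (simp add: int_span_stable_def)
  moreover have "1 \<in> ?B"
    using d(1) by (auto intro: rev_image_eqI[of 0])
  ultimately show thesis
    by (intro that[of ?B]) simp_all
qed

lemma algebraic_int_obtains_common_int_span_stable:
  fixes x y :: "'a::field_char_0"
  assumes "algebraic_int x" "algebraic_int y"
  obtains C where "finite C" "1 \<in> C" "int_span_stable x C" "int_span_stable y C"
proof -
  obtain A where A: "finite A" "1 \<in> A" "int_span_stable x A"
    using assms(1) by (rule algebraic_int_obtains_int_span_stable)
  obtain B where B: "finite B" "1 \<in> B" "int_span_stable y B"
    using assms(2) by (rule algebraic_int_obtains_int_span_stable)
  let ?C = "{a * b | a b. a \<in> A \<and> b \<in> B}"
  have "(x * a) * b \<in> int_span ?C" "a * (y * b) \<in> int_span ?C" if "a \<in> A" "b \<in> B" for a b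
    using that A(3) B(3) unfolding int_span_stable_def
    by (blast intro: int_span_mult int_module.span_base)+
  then have "int_span_stable x ?C" "int_span_stable y ?C"
    by (auto simp: int_span_stable_def mult_ac)
  moreover have "finite ?C"
    using A(1) B(1) finite_image_set2[of "\<lambda>a. a \<in> A" "\<lambda>b. b \<in> B" "(*)"] by simp
  moreover have "1 \<in> ?C"
    using A(2) B(2) by force
  ultimately show thesis
    using that by blast
qed

lemma algebraic_int_plus:
  fixes x y :: "'a::field_char_0"
  assumes "algebraic_int x" "algebraic_int y"
  shows "algebraic_int (x + y)"
proof -
  obtain C where "finite C" "1 \<in> C" "int_span_stable x C" "int_span_stable y C"
    using assms by (rule algebraic_int_obtains_common_int_span_stable)
  then show ?thesis
    by (intro algebraic_int_if_int_span_stable int_span_stable_plus)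
qed

lemma algebraic_int_times:
  fixes x y :: "'a::field_char_0"
  assumes "algebraic_int x" "algebraic_int y"
  shows "algebraic_int (x * y)"
proof -
  obtain C where "finite C" "1 \<in> C" "int_span_stable x C" "int_span_stable y C"
    using assms by (rule algebraic_int_obtains_common_int_span_stable)
  then show ?thesis
    by (intro algebraic_int_if_int_span_stable int_span_stable_times)
qed

lemma algebraic_int_prod:
  fixes f :: "'i \<Rightarrow> 'a::field_char_0"
  shows "(\<And>i. i \<in> S \<Longrightarrow> algebraic_int (f i)) \<Longrightarrow> algebraic_int (prod f S)"
  by (induction S rule: infinite_finite_induct) (auto intro: algebraic_int_times)

subsection \<open>Field norms of algebraic integers\<close>

lemma (in Group.monoid) Dedekind_independence:
  fixes F :: "('a \<Rightarrow> 'c::idom) set"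
  assumes "finite F" and "F \<subseteq> extensional (carrier G)"
    and "\<And>f x y. f \<in> F \<Longrightarrow> x \<in> carrier G \<Longrightarrow> y \<in> carrier G \<Longrightarrow> f (x \<otimes> y) = f x * f y"
    and "\<And>f. f \<in> F \<Longrightarrow> f \<one> = 1"
    and "\<And>x. x \<in> carrier G \<Longrightarrow> (\<Sum>f\<in>F. c f * f x) = 0"
    and "f \<in> F"
  shows "c f = 0"
  using assms
proof (induction F arbitrary: c f rule: finite_induct)
  case (insert g F)
  note ext = insert.prems(1) and mult = insert.prems(2) and one = insert.prems(3)
    and relation = insert.prems(4)
  have zero_on_F: "c h = 0" if h: "h \<in> F" for h
  proof -
    have "h \<noteq> g" "h \<in> extensional (carrier G)" "g \<in> extensional (carrier G)"
      using h insert.hyps ext by auto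
    then obtain y where y: "y \<in> carrier G" "h y \<noteq> g y"
      by (metis extensionalityI)
    have "c h * (h y - g y) = 0"
    proof (rule insert.IH[where c = "\<lambda>f. c f * (f y - g y)"])
      fix x assume x: "x \<in> carrier G"
      \<comment> \<open>Evaluate the relation at \<open>y \<otimes> x\<close> and subtract \<open>g y\<close> times the relation at \<open>x\<close>;
        the term of \<open>g\<close> cancels.\<close>
      have "(\<Sum>f\<in>F. c f * (f y - g y) * f x) = (\<Sum>f\<in>insert g F. c f * (f y - g y) * f x)"
        using insert.hyps by simp
      also have "\<dots> = (\<Sum>f\<in>insert g F. c f * f (y \<otimes> x) - g y * (c f * f x))"
        by (rule sum.cong) (simp_all add: mult x y algebra_simps del: insert_iff)
      also have "\<dots> = 0"
        using relation x y by (simp add: sum_subtractf del: sum.insert flip: sum_distrib_left)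
      finally show "(\<Sum>f\<in>F. c f * (f y - g y) * f x) = 0" .
    qed (use ext mult one h in auto)
    then show ?thesis
      using y by simp
  qed
  have "c g = (\<Sum>f\<in>insert g F. c f * f \<one>)"
    using insert.hyps one zero_on_F by simp
  then show ?case
    using relation zero_on_F insert.prems(5) by auto
qed simp

definition rat_spans :: "nat \<Rightarrow> (nat \<Rightarrow> 'a::field_char_0) \<Rightarrow> 'a set \<Rightarrow> bool" where
  "rat_spans n b K \<longleftrightarrow>
     (\<forall>i<n. b i \<in> K) \<and> (\<forall>x\<in>K. \<exists>r :: nat \<Rightarrow> rat. x = (\<Sum>i<n. of_rat (r i) * b i))"

lemma combine_ring_of_type_algebra:
  fixes Ks Us :: "'a::ring_1 list"
  assumes "length Ks = length Us"
  shows "ring.combine ring_of_type_algebra Ks Us = (\<Sum>i<length Us. Ks ! i * Us ! i)"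
proof -
  interpret ring "ring_of_type_algebra :: 'a ring" by (rule ring_ring_of_type_algebra)
  show ?thesis
    using assms
    by (induction Ks Us rule: list_induct2)
      (simp_all add: sum.lessThan_Suc_shift del: sum.lessThan_Suc)
qed

lemma rat_spans_if_dimension_Rats:
  fixes K :: "'a::field_char_0 set"
  assumes "ring.dimension ring_of_type_algebra n \<rat> K"
  obtains b where "rat_spans n b K"
proof -
  interpret field "ring_of_type_algebra :: 'a ring" ..
  obtain Vs where Vs: "length Vs = n" "Span \<rat> Vs = K"
    using exists_base[OF subfield_Rats assms] by blast
  have Vs_carrier: "set Vs \<subseteq> carrier ring_of_type_algebra"
    by simp
  have "Vs ! i \<in> K" if "i < n" for i
    using Span_base_incl[OF subfield_Rats Vs_carrier] that Vs by auto
  moreover have "\<exists>r :: nat \<Rightarrow> rat. x = (\<Sum>i<n. of_rat (r i) * Vs ! i)" if "x \<in> K" for x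
  proof -
    have "x \<in> Span \<rat> Vs"
      using that Vs(2) by simp
    then obtain Ks where Ks: "set Ks \<subseteq> \<rat>" "length Ks = n" "x = combine Ks Vs"
      unfolding Span_mem_iff_length_version[OF subfield_Rats Vs_carrier] Vs(1) by blast
    have "\<exists>q. Ks ! i = of_rat q" if "i < n" for i
      using subsetD[OF Ks(1) nth_mem[of i Ks]] Ks(2) that by (auto elim: Rats_cases)
    then obtain r where "\<And>i. i < n \<Longrightarrow> Ks ! i = of_rat (r i)"
      by metis
    then have "x = (\<Sum>i<n. of_rat (r i) * Vs ! i)"
      using Ks(2,3) Vs(1) by (simp add: combine_ring_of_type_algebra)
    then show ?thesis by blast
  qed
  ultimately show thesis
    by (intro that[of "(!) Vs"]) (simp add: rat_spans_def)
qed

locale number_field_embeddings =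
  fixes K :: "real set" and n :: nat and \<sigma> :: "nat \<Rightarrow> real \<Rightarrow> real"
  assumes number_field: "number_field n K"
    and embeddings: "bij_betw \<sigma> {1..n} (real_embeddings K)"
begin

sublocale type_subfield K
  by (rule type_subfield.intro) (use number_field in \<open>simp add: number_field_def\<close>)

lemma rational_spanning_family:
  obtains b where "rat_spans n b K"
  using number_field rat_spans_if_dimension_Rats unfolding number_field_def by blast

lemma embedding: "t \<in> {1..n} \<Longrightarrow> subfield_embedding K (\<sigma> t)"
  using bij_betwE[OF embeddings] by unfold_locales (auto simp: real_embeddings_def)

lemma dimension_pos: "n > 0"
proof (rule ccontr)
  assume "\<not> n > 0"
  moreover obtain b where "rat_spans n b K"
    by (rule rational_spanning_family)
  ultimately show False
    using one_mem by (auto simp: rat_spans_def)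
qed

lemma embeddings_independent:
  assumes "\<And>x. x \<in> K \<Longrightarrow> (\<Sum>t=1..n. c t * \<sigma> t x) = 0" and t: "t \<in> {1..n}"
  shows "c t = 0"
proof -
  interpret monoid: Group.monoid "subring_of K"
    using ring.subring_is_ring[OF ring_ring_of_type_algebra subring] by (rule ring.is_monoid)
  define index where "index = inv_into {1..n} \<sigma>"
  have index: "index (\<sigma> t) = t" if "t \<in> {1..n}" for t
    using bij_betw_inv_into_left[OF embeddings that] by (simp add: index_def)
  have "c (index (\<sigma> t)) = 0"
  proof (rule monoid.Dedekind_independence[where F = "real_embeddings K" and c = "c \<circ> index",
        unfolded o_apply])
    show "finite (real_embeddings K)"
      using embeddings bij_betw_finite by blast
    show "\<sigma> t \<in> real_embeddings K"
      using embeddings t by (rule bij_betw_apply)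
    fix x assume "x \<in> carrier (subring_of K)"
    then have "(\<Sum>t=1..n. c (index (\<sigma> t)) * \<sigma> t x) = 0"
      using assms(1) by (simp add: index)
    then show "(\<Sum>f\<in>real_embeddings K. c (index f) * f x) = 0"
      using sum.reindex_bij_betw[OF embeddings, of "\<lambda>f. c (index f) * f x"] by simp
  qed (auto simp: real_embeddings_def dest: ring_hom_mult ring_hom_one)
  then show ?thesis
    using index[OF t] by simp
qed

definition conjugate_matrix :: "(nat \<Rightarrow> real) \<Rightarrow> real mat" where
  "conjugate_matrix b = mat n n (\<lambda>(i, t). \<sigma> (Suc t) (b i))"

lemma conjugate_matrix_carrier: "conjugate_matrix b \<in> carrier_mat n n"
  by (simp add: conjugate_matrix_def)

lemma embedding_rat_combination:
  assumes "t \<in> {1..n}" "\<And>i. i < n \<Longrightarrow> b i \<in> K"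
  shows "\<sigma> t (\<Sum>i<n. of_rat (r i) * b i) = (\<Sum>i<n. of_rat (r i) * \<sigma> t (b i))"
proof -
  interpret subfield_embedding K "\<sigma> t" using assms(1) by (rule embedding)
  show ?thesis
    using assms(2) by (subst hom_sum) (simp_all add: hom_mult hom_of_rat mult_mem of_rat_mem)
qed

lemma det_conjugate_matrix_nonzero:
  assumes b: "rat_spans n b K"
  shows "Determinant.det (conjugate_matrix b) \<noteq> 0"
proof
  assume "Determinant.det (conjugate_matrix b) = 0"
  then obtain v where v: "v \<in> carrier_vec n" "v \<noteq> 0\<^sub>v n" "conjugate_matrix b *\<^sub>v v = 0\<^sub>v n"
    using det_0_iff_vec_prod_zero[OF conjugate_matrix_carrier] by blast
  have kernel: "(\<Sum>t<n. \<sigma> (Suc t) (b i) * v $ t) = 0" if "i < n" for i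
  proof -
    have "(conjugate_matrix b *\<^sub>v v) $ i = (\<Sum>t<n. \<sigma> (Suc t) (b i) * v $ t)"
      using that v(1) by (simp add: conjugate_matrix_def scalar_prod_def atLeast0LessThan)
    then show ?thesis
      using v(3) that by simp
  qed
  have "v $ (t - 1) = 0" if "t \<in> {1..n}" for t
    using _ that
  proof (rule embeddings_independent)
    fix x assume "x \<in> K"
    then obtain r :: "nat \<Rightarrow> rat" where x: "x = (\<Sum>i<n. of_rat (r i) * b i)"
      using b by (auto simp: rat_spans_def)
    have \<sigma>_x: "\<sigma> (Suc t) x = (\<Sum>i<n. of_rat (r i) * \<sigma> (Suc t) (b i))" if "t < n" for t
      using b that unfolding x rat_spans_def by (intro embedding_rat_combination) auto
    have "(\<Sum>t=1..n. v $ (t - 1) * \<sigma> t x) = (\<Sum>t<n. v $ t * \<sigma> (Suc t) x)"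
      by (simp add: sum.atLeast1_atMost_eq)
    also have "\<dots> = (\<Sum>t<n. \<Sum>i<n. of_rat (r i) * (\<sigma> (Suc t) (b i) * v $ t))"
      by (simp add: \<sigma>_x sum_distrib_left mult_ac)
    also have "\<dots> = (\<Sum>i<n. of_rat (r i) * (\<Sum>t<n. \<sigma> (Suc t) (b i) * v $ t))"
      by (subst sum.swap) (simp add: sum_distrib_left)
    finally show "(\<Sum>t=1..n. v $ (t - 1) * \<sigma> t x) = 0"
      using kernel by simp
  qed
  from this[of "Suc _"] have "v = 0\<^sub>v n"
    using v(1) by (intro eq_vecI) auto
  then show False
    using v(2) by simp
qed

lemma rat_matrix_mult_conjugate_matrix:
  assumes b: "rat_spans n b K" and x: "x \<in> K" and M: "M \<in> carrier_mat n n"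
    and x_b: "\<And>i. i < n \<Longrightarrow> x * b i = (\<Sum>j<n. of_rat (M $$ (i, j)) * b j)"
  shows "map_mat of_rat M * conjugate_matrix b
    = conjugate_matrix b * mat_diag n (\<lambda>t. \<sigma> (Suc t) x)" (is "?M * ?E = ?E * ?conjugates")
proof (rule eq_matI)
  note [simp] = conjugate_matrix_carrier
  have b_mem: "b i \<in> K" if "i < n" for i
    using b that by (simp add: rat_spans_def)
  fix i t assume "i < dim_row (?E * ?conjugates)" "t < dim_col (?E * ?conjugates)"
  then have it: "i < n" "t < n"
    by (simp_all add: conjugate_matrix_def mat_diag_def)
  interpret subfield_embedding K "\<sigma> (Suc t)"
    using it(2) by (intro embedding) simp
  have "(?M * ?E) $$ (i, t) = (\<Sum>j<n. of_rat (M $$ (i, j)) * \<sigma> (Suc t) (b j))"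
    using it M by (simp add: conjugate_matrix_def scalar_prod_def atLeast0LessThan)
  also have "\<dots> = \<sigma> (Suc t) (x * b i)"
    using it b_mem by (simp add: x_b embedding_rat_combination)
  also have "\<dots> = ?E $$ (i, t) * \<sigma> (Suc t) x"
    using it x b_mem by (simp add: hom_mult conjugate_matrix_def mult.commute)
  also have "\<dots> = (?E * ?conjugates) $$ (i, t)"
    using it by (simp add: mat_diag_mult_right[of ?E n n])
  finally show "(?M * ?E) $$ (i, t) = (?E * ?conjugates) $$ (i, t)" .
qed (use M in \<open>auto simp: conjugate_matrix_def mat_diag_def\<close>)

lemma field_norm_eq_det:
  assumes b: "rat_spans n b K" and x: "x \<in> K" and M: "M \<in> carrier_mat n n"
    and x_b: "\<And>i. i < n \<Longrightarrow> x * b i = (\<Sum>j<n. of_rat (M $$ (i, j)) * b j)"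
  shows "field_norm n \<sigma> x = of_rat (Determinant.det M)"
proof -
  interpret of_rat: comm_ring_hom "of_rat :: rat \<Rightarrow> real"
    by unfold_locales (simp_all add: of_rat_add of_rat_mult)
  let ?E = "conjugate_matrix b"
  let ?conjugates = "mat_diag n (\<lambda>t. \<sigma> (Suc t) x)"
  have "Determinant.det (map_mat of_rat M) * Determinant.det ?E
      = Determinant.det ?E * Determinant.det ?conjugates"
    using rat_matrix_mult_conjugate_matrix[OF assms] M
    by (metis conjugate_matrix_carrier det_mult map_carrier_mat mat_diag_dim)
  moreover have "Determinant.det ?conjugates = field_norm n \<sigma> x"
    by (subst det_upper_triangular[of _ n])
      (auto simp: mat_diag_def prod_list_diag_prod field_norm_def prod.atLeast1_atMost_eq
        atLeast0LessThan)
  ultimately show ?thesis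
    using det_conjugate_matrix_nonzero[OF b] by simp
qed

lemma field_norm_Rats:
  assumes "x \<in> K"
  shows "field_norm n \<sigma> x \<in> \<rat>"
proof -
  obtain b where b: "rat_spans n b K"
    by (rule rational_spanning_family)
  have "\<exists>r :: nat \<Rightarrow> rat. x * b i = (\<Sum>j<n. of_rat (r j) * b j)" if "i < n" for i
    using b that mult_mem[OF assms] by (simp add: rat_spans_def)
  then obtain r :: "nat \<Rightarrow> nat \<Rightarrow> rat"
    where "\<And>i. i < n \<Longrightarrow> x * b i = (\<Sum>j<n. of_rat (r i j) * b j)"
    by metis
  then have "field_norm n \<sigma> x = of_rat (Determinant.det (mat n n (\<lambda>(i, j). r i j)))"
    by (intro field_norm_eq_det[OF b assms]) simp_all
  then show ?thesis by simp
qed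

lemma field_norm_Ints:
  assumes "x \<in> ring_of_integers K"
  shows "field_norm n \<sigma> x \<in> \<int>"
proof (rule rational_algebraic_int_is_int)
  have x: "x \<in> K" "algebraic_int x"
    using assms by (simp_all add: ring_of_integers_def)
  show "field_norm n \<sigma> x \<in> \<rat>"
    using x(1) by (rule field_norm_Rats)
  show "algebraic_int (field_norm n \<sigma> x)"
    unfolding field_norm_def
    by (intro algebraic_int_prod subfield_embedding.algebraic_int_hom[OF embedding] x)
qed

lemma field_norm_mult:
  assumes "x \<in> K" "y \<in> K"
  shows "field_norm n \<sigma> (x * y) = field_norm n \<sigma> x * field_norm n \<sigma> y"
  using assms subfield_embedding.hom_mult[OF embedding] by (simp add: field_norm_def prod.distrib)

lemma subring_ring_of_integers: "subring (ring_of_integers K) ring_of_type_algebra"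
  by (auto simp: subring_ring_of_type_algebra_iff ring_of_integers_def zero_mem one_mem uminus_mem
      add_mem mult_mem algebraic_int_plus algebraic_int_times)

end

subsection \<open>Factorial domains and left principal ideals\<close>

lemma (in factorial_domain) ring_prime_factorization:
  assumes d: "d \<in> carrier R" "d \<noteq> \<zero>" "d \<notin> Units (mult_of R)"
  obtains ps where "\<forall>p\<in>set ps. p \<in> carrier R \<and> ring_prime p" "foldr (\<otimes>) ps \<one> = d"
proof -
  obtain ps where ps: "set ps \<subseteq> carrier (mult_of R)" "factors (mult_of R) ps d"
    using factorial_monoid.factors_exist[OF factorial_monoid_axioms, of d] d by auto
  have "p \<in> carrier R \<and> ring_prime p" if "p \<in> set ps" for p
  proof -
    have "p \<in> carrier (mult_of R)" "Divisibility.irreducible (mult_of R) p"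
      using ps that by (auto simp: factors_def)
    then show ?thesis
      using factorial_monoid.irreducible_prime[OF factorial_monoid_axioms] ring_primeI'[of p]
      by simp
  qed
  moreover have "foldr (\<otimes>) ps \<one> = d"
    using ps(2) by (simp add: factors_def)
  ultimately show thesis
    using that by blast
qed

text \<open>Divide \<open>d\<close> successively by its prime factors until the quotient leaves \<open>J\<close>.\<close>

lemma (in factorial_domain) prime_descent:
  assumes absorbing: "\<And>u x. u \<in> carrier R \<Longrightarrow> x \<in> J \<Longrightarrow> u \<otimes> x \<in> J"
    and d: "d \<in> carrier R" "d \<noteq> \<zero>" "d \<in> J" and one: "\<one> \<notin> J"
  obtains p e where "p \<in> carrier R" "ring_prime p" "e \<in> carrier R" "p \<otimes> e \<in> J" "e \<notin> J"
proof -
  have "d \<notin> Units (mult_of R)"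
  proof
    assume "d \<in> Units (mult_of R)"
    then obtain x where "x \<in> carrier R" "x \<otimes> d = \<one>"
      by (auto simp: Units_def)
    then show False
      using absorbing d(3) one by metis
  qed
  then obtain ps where "\<forall>p\<in>set ps. p \<in> carrier R \<and> ring_prime p" "foldr (\<otimes>) ps \<one> = d"
    by (rule ring_prime_factorization[OF d(1,2)])
  then have "\<forall>p\<in>set ps. p \<in> carrier R \<and> ring_prime p" "foldr (\<otimes>) ps \<one> \<in> J"
    using d(3) by simp_all
  then have "\<exists>p e. p \<in> carrier R \<and> ring_prime p \<and> e \<in> carrier R \<and> p \<otimes> e \<in> J \<and> e \<notin> J"
  proof (induction ps)
    case (Cons p ps)
    have "foldr (\<otimes>) ps \<one> \<in> carrier R"
      using Cons.prems(1) by (intro multlist_closed) auto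
    then show ?case
      using Cons by (cases "foldr (\<otimes>) ps \<one> \<in> J") auto
  qed (use one in simp)
  then show thesis
    using that by blast
qed

lemma (in ring) cgenideal_zero: "PIdl \<zero> = {\<zero>}"
proof
  show "PIdl \<zero> \<subseteq> {\<zero>}"
    by (auto simp: cgenideal_def)
qed (simp add: cgenideal_self)

lemma cgenideal_subset_left_ideal: "left_ideal I R \<Longrightarrow> D \<in> I \<Longrightarrow> PIdl\<^bsub>R\<^esub> D \<subseteq> I"
  by (auto simp: left_ideal_def cgenideal_def)

lemma left_ideal_principal_if_Dedekind_Hasse:
  fixes R :: "'a ring" (structure) and N :: "'a \<Rightarrow> nat"
  assumes "ring R"
    and Dedekind_Hasse: "\<And>a b. a \<in> carrier R \<Longrightarrow> b \<in> carrier R \<Longrightarrow> b \<noteq> \<zero> \<Longrightarrow> a \<notin> PIdl b \<Longrightarrow>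
      \<exists>p\<in>carrier R. \<exists>q\<in>carrier R. p \<otimes> a \<oplus> q \<otimes> b \<noteq> \<zero> \<and> N (p \<otimes> a \<oplus> q \<otimes> b) < N b"
    and I: "left_ideal I R"
  shows "\<exists>D\<in>carrier R. I = PIdl D"
proof -
  interpret ring R by fact
  interpret I: additive_subgroup I R
    using I by (simp add: left_ideal_def)
  show ?thesis
  proof (cases "I = {\<zero>}")
    case True
    then show ?thesis
      using cgenideal_zero by blast
  next
    case False
    then obtain L where "L \<in> I \<and> L \<noteq> \<zero>"
      using I.zero_closed by blast
    from ex_has_least_nat[where P = "\<lambda>L. L \<in> I \<and> L \<noteq> \<zero>" and m = N, OF this]
    obtain D where D: "D \<in> I" "D \<noteq> \<zero>"
      and minimal: "\<And>L. L \<in> I \<Longrightarrow> L \<noteq> \<zero> \<Longrightarrow> N D \<le> N L"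
      by blast
    have "M \<in> PIdl D" if M: "M \<in> I" for M
    proof (rule ccontr)
      assume "M \<notin> PIdl D"
      then obtain p q where pq: "p \<in> carrier R" "q \<in> carrier R" "p \<otimes> M \<oplus> q \<otimes> D \<noteq> \<zero>"
        "N (p \<otimes> M \<oplus> q \<otimes> D) < N D"
        using Dedekind_Hasse[OF I.a_Hcarr[OF M] I.a_Hcarr[OF D(1)] D(2)] by blast
      have "p \<otimes> M \<oplus> q \<otimes> D \<in> I"
        using pq(1,2) M D(1) I by (auto simp: left_ideal_def intro: I.a_closed)
      then show False
        using minimal pq(3,4) by force
    qed
    then show ?thesis
      using I.a_Hcarr[OF D(1)] cgenideal_subset_left_ideal[OF I D(1)] by blast
  qed
qed

subsection \<open>Quaternions\<close>

lemmas quat_arith_defs = zero_quat_def one_quat_def plus_quat_def uminus_quat_def minus_quat_def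
  scaleR_quat_def times_quat_def of_real_def

lemma qnorm_eq: "qnorm L = (qRe L)\<^sup>2 + (qI L)\<^sup>2 + (qJ L)\<^sup>2 + (qK L)\<^sup>2"
  by (simp add: qnorm_def qcnj_def times_quat_def power2_eq_square)

lemma qnorm_nonneg: "qnorm L \<ge> 0"
  by (simp add: qnorm_eq)

lemma qnorm_eq_0_iff: "qnorm L = 0 \<longleftrightarrow> L = 0"
  by (simp add: qnorm_eq quat_eq_iff zero_quat_def add_nonneg_eq_0_iff)

lemma qnorm_mult: "qnorm (L * M) = qnorm L * qnorm M"
  by (simp add: qnorm_eq times_quat_def power2_eq_square algebra_simps)

lemma qcnj_mult_self: "qcnj L * L = of_real (qnorm L)"
  by (simp add: qnorm_eq qcnj_def quat_arith_defs power2_eq_square)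

instantiation quat :: division_ring
begin

definition inverse_quat :: "quat \<Rightarrow> quat" where
  "inverse_quat L = qcnj L /\<^sub>R qnorm L"

definition divide_quat :: "quat \<Rightarrow> quat \<Rightarrow> quat" where
  "divide_quat L M = L * inverse M"

instance
proof
  fix L :: quat
  show "inverse L * L = 1" "L * inverse L = 1" if "L \<noteq> 0"
    using that
    by (simp_all add: inverse_quat_def qcnj_mult_self qnorm_eq_0_iff of_real_def
        flip: of_real_qnorm)
qed (simp_all add: divide_quat_def inverse_quat_def qnorm_eq_0_iff)

end

lemma qnorm_scaleR_divide: "qnorm M \<noteq> 0 \<Longrightarrow> qnorm M *\<^sub>R (L / M) = L * qcnj M"
  by (simp add: divide_quat_def inverse_quat_def)

definition norm_form :: "real \<Rightarrow> real \<Rightarrow> real \<Rightarrow> real \<Rightarrow> real \<Rightarrow> real \<Rightarrow> real \<Rightarrow> real \<Rightarrow> real" where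
  "norm_form A B \<mu> \<nu> x y z w =
     x * x + \<mu> * x * y + A * y * y + B * (z * z + \<mu> * z * w + A * w * w) + \<nu> * (y * z - x * w)"

locale quat_parameters =
  fixes A B \<mu> \<nu> :: real
  assumes disc_S_pos: "disc_S A \<mu> > 0" and disc_T_pos: "disc_T A B \<mu> \<nu> > 0"
begin

abbreviation "\<alpha> \<equiv> quat_alpha A \<mu>"
abbreviation "\<beta> \<equiv> quat_beta A B \<mu> \<nu>"

definition quat_elt :: "real \<Rightarrow> real \<Rightarrow> real \<Rightarrow> real \<Rightarrow> quat" where
  "quat_elt x y z w = of_real x + y *\<^sub>R \<alpha> + z *\<^sub>R \<beta> + w *\<^sub>R (\<alpha> * \<beta>)"

text \<open>With \<open>m = \<mu>/2\<close>, \<open>s = \<surd>S/2\<close>, \<open>p = \<nu>/\<surd>S\<close> and \<open>q = \<surd>T/\<surd>S\<close>, all identities between \<open>\<alpha>\<close>, \<open>\<beta>\<close> and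
  the parameters become polynomial.\<close>

lemma polynomial_parameters:
  obtains m s p q where "\<mu> = 2 * m" "\<nu> = 2 * s * p" "A = s * s + m * m" "B = p * p + q * q"
    "\<alpha> = Quat m s 0 0" "\<beta> = Quat 0 p q 0"
proof -
  define m s p q where "m = \<mu> / 2" and "s = sqrt (disc_S A \<mu>) / 2"
    and "p = \<nu> / (2 * s)" and "q = sqrt (disc_T A B \<mu> \<nu>) / (2 * s)"
  have s: "s \<noteq> 0" "s * s = disc_S A \<mu> / 4"
    using disc_S_pos by (simp_all add: s_def)
  have pq: "p * (2 * s) = \<nu>" "q * (2 * s) = sqrt (disc_T A B \<mu> \<nu>)"
    using s(1) by (simp_all add: p_def q_def)
  have A: "A = s * s + m * m"
    by (simp add: s(2) disc_S_def power2_eq_square m_def diff_divide_distrib)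
  have "(p * p + q * q) * (4 * (s * s)) = (p * (2 * s))\<^sup>2 + (q * (2 * s))\<^sup>2"
    by (simp add: algebra_simps power2_eq_square)
  also have "\<dots> = \<nu>\<^sup>2 + disc_T A B \<mu> \<nu>"
    unfolding pq using disc_T_pos by simp
  also have "\<dots> = B * (4 * (s * s))"
    by (simp add: s(2) disc_T_def)
  finally have B: "B = p * p + q * q"
    using s(1) by simp
  have "\<alpha> = Quat m s 0 0" "\<beta> = Quat 0 p q 0"
    by (simp_all add: quat_alpha_def quat_beta_def quat_i_def quat_j_def quat_arith_defs
        m_def p_def q_def s_def inverse_eq_divide)
  then show thesis
    using that[of m s p q] A B pq(1) by (simp add: m_def mult_ac)
qed

lemma alpha_square: "\<alpha> * \<alpha> = \<mu> *\<^sub>R \<alpha> - of_real A"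
  by (rule polynomial_parameters) (simp add: quat_arith_defs)

lemma beta_square: "\<beta> * \<beta> = - of_real B"
  by (rule polynomial_parameters) (simp add: quat_arith_defs)

lemma beta_alpha: "\<beta> * \<alpha> = \<mu> *\<^sub>R \<beta> - of_real \<nu> - \<alpha> * \<beta>"
  by (rule polynomial_parameters) (simp add: quat_arith_defs)

lemma alpha_quat_elt:
  "\<alpha> * quat_elt x y z w = quat_elt (- (A * y)) (x + \<mu> * y) (- (A * w)) (z + \<mu> * w)"
proof -
  have alpha_alpha_beta: "\<alpha> * (\<alpha> * \<beta>) = \<mu> *\<^sub>R (\<alpha> * \<beta>) - A *\<^sub>R \<beta>"
    by (simp add: alpha_square left_diff_distrib of_real_def flip: mult.assoc)
  show ?thesis
    by (simp add: quat_elt_def distrib_left alpha_square alpha_alpha_beta of_real_def algebra_simps)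
qed

lemma beta_quat_elt:
  "\<beta> * quat_elt x y z w
    = quat_elt (- (\<nu> * y + B * z + \<mu> * B * w)) (B * w) (x + \<mu> * y - \<nu> * w) (- y)"
proof -
  have beta_alpha_beta: "\<beta> * (\<alpha> * \<beta>) = - (\<mu> * B) *\<^sub>R 1 - \<nu> *\<^sub>R \<beta> + B *\<^sub>R \<alpha>"
    by (simp add: beta_alpha left_diff_distrib beta_square mult.assoc[of \<alpha> \<beta> \<beta>] of_real_def
        flip: mult.assoc[of \<beta> \<alpha> \<beta>])
  show ?thesis
    by (simp add: quat_elt_def distrib_left beta_square beta_alpha beta_alpha_beta of_real_def
        algebra_simps)
qed

lemma quat_elt_add:
  "quat_elt x y z w + quat_elt x' y' z' w' = quat_elt (x + x') (y + y') (z + z') (w + w')"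
  by (simp add: quat_elt_def scaleR_add_left)

lemma scaleR_quat_elt: "u *\<^sub>R quat_elt x y z w = quat_elt (u * x) (u * y) (u * z) (u * w)"
  by (simp add: quat_elt_def scaleR_add_right of_real_def)

lemma quat_elt_mult:
  "quat_elt x y z w * M = x *\<^sub>R M + y *\<^sub>R (\<alpha> * M) + z *\<^sub>R (\<beta> * M) + w *\<^sub>R (\<alpha> * (\<beta> * M))"
  by (simp add: quat_elt_def distrib_right of_real_def mult.assoc)

lemma qcnj_quat_elt: "qcnj (quat_elt x y z w) = quat_elt (x + \<mu> * y - \<nu> * w) (- y) (- z) (- w)"
  unfolding quat_elt_def
  by (rule polynomial_parameters) (simp add: qcnj_def quat_arith_defs algebra_simps)

lemma qnorm_quat_elt: "qnorm (quat_elt x y z w) = norm_form A B \<mu> \<nu> x y z w"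
  unfolding quat_elt_def
  by (rule polynomial_parameters)
    (simp add: qnorm_eq norm_form_def quat_arith_defs algebra_simps power2_eq_square)

lemma norm_form_nonneg: "norm_form A B \<mu> \<nu> x y z w \<ge> 0"
  using qnorm_nonneg[of "quat_elt x y z w"] by (simp add: qnorm_quat_elt)

end

subsection \<open>Quaternion orders\<close>

locale quaternion_order = number_field_embeddings +
  fixes A B \<mu> \<nu> :: real
  assumes embedding_1: "\<forall>x\<in>K. \<sigma> 1 x = x"
    and parameters_integral: "A \<in> ring_of_integers K" "B \<in> ring_of_integers K"
      "\<mu> \<in> ring_of_integers K" "\<nu> \<in> ring_of_integers K"
    and totally_positive_S: "totally_positive n \<sigma> (disc_S A \<mu>)"
    and totally_positive_T: "totally_positive n \<sigma> (disc_T A B \<mu> \<nu>)"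
begin

abbreviation "R \<equiv> ring_of_integers K"
abbreviation "H \<equiv> quat_order K A B \<mu> \<nu>"

lemma integers_mem_K: "x \<in> R \<Longrightarrow> x \<in> K"
  by (simp add: ring_of_integers_def)

lemmas parameters_mem_K = parameters_integral[THEN integers_mem_K]

lemma integers_closed:
  "0 \<in> R" "1 \<in> R" "x \<in> R \<Longrightarrow> - x \<in> R" "x \<in> R \<Longrightarrow> y \<in> R \<Longrightarrow> x + y \<in> R"
  "x \<in> R \<Longrightarrow> y \<in> R \<Longrightarrow> x * y \<in> R" "x \<in> R \<Longrightarrow> y \<in> R \<Longrightarrow> x - y \<in> R"
proof -
  note closed = subring_ring_of_integers[unfolded subring_ring_of_type_algebra_iff]
  show "0 \<in> R" "1 \<in> R" "x \<in> R \<Longrightarrow> - x \<in> R" "x \<in> R \<Longrightarrow> y \<in> R \<Longrightarrow> x + y \<in> R"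
    "x \<in> R \<Longrightarrow> y \<in> R \<Longrightarrow> x * y \<in> R"
    using closed by blast+
  show "x \<in> R \<Longrightarrow> y \<in> R \<Longrightarrow> x - y \<in> R"
    using closed by (metis diff_conv_add_uminus)
qed

lemma discriminants_mem_K: "disc_S A \<mu> \<in> K" "disc_T A B \<mu> \<nu> \<in> K"
  using parameters_mem_K of_nat_mem[of 4]
  by (auto simp: disc_S_def disc_T_def intro!: diff_mem mult_mem power_mem)

lemma quat_parameters_conjugate:
  assumes t: "t \<in> {1..n}"
  shows "quat_parameters (\<sigma> t A) (\<sigma> t B) (\<sigma> t \<mu>) (\<sigma> t \<nu>)"
proof
  interpret subfield_embedding K "\<sigma> t" using t by (rule embedding)
  have four: "4 \<in> K" "\<sigma> t 4 = 4"
    using of_nat_mem[of 4] hom_of_nat[of 4] by simp_all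
  note hom = hom_diff hom_mult hom_power mult_mem diff_mem power_mem
  have S: "disc_S (\<sigma> t A) (\<sigma> t \<mu>) = \<sigma> t (disc_S A \<mu>)"
    by (simp add: disc_S_def hom four parameters_mem_K)
  have T: "disc_T (\<sigma> t A) (\<sigma> t B) (\<sigma> t \<mu>) (\<sigma> t \<nu>) = \<sigma> t (disc_T A B \<mu> \<nu>)"
    by (simp add: disc_T_def hom parameters_mem_K discriminants_mem_K S)
  show "disc_S (\<sigma> t A) (\<sigma> t \<mu>) > 0" "disc_T (\<sigma> t A) (\<sigma> t B) (\<sigma> t \<mu>) (\<sigma> t \<nu>) > 0"
    using totally_positive_S totally_positive_T t unfolding S T totally_positive_def by blast+
qed

sublocale quat_parameters A B \<mu> \<nu>
  using quat_parameters_conjugate[of 1] dimension_pos embedding_1 parameters_mem_K by simp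

lemma order_iff: "L \<in> H \<longleftrightarrow> (\<exists>x\<in>R. \<exists>y\<in>R. \<exists>z\<in>R. \<exists>w\<in>R. L = quat_elt x y z w)"
  by (auto simp: quat_order_def quat_elt_def)

lemma order_cases:
  assumes "L \<in> H"
  obtains x y z w where "L = quat_elt x y z w" "x \<in> R" "y \<in> R" "z \<in> R" "w \<in> R"
  using assms by (auto simp: order_iff)

lemma quat_elt_mem: "x \<in> R \<Longrightarrow> y \<in> R \<Longrightarrow> z \<in> R \<Longrightarrow> w \<in> R \<Longrightarrow> quat_elt x y z w \<in> H"
  by (auto simp: order_iff)

lemma order_add: "L \<in> H \<Longrightarrow> M \<in> H \<Longrightarrow> L + M \<in> H"
  by (elim order_cases) (simp add: quat_elt_add quat_elt_mem integers_closed)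

lemma order_scaleR: "u \<in> R \<Longrightarrow> L \<in> H \<Longrightarrow> u *\<^sub>R L \<in> H"
  by (elim order_cases) (simp add: scaleR_quat_elt quat_elt_mem integers_closed)

lemma order_mult:
  assumes "L \<in> H" "M \<in> H"
  shows "L * M \<in> H"
proof -
  have generators: "\<alpha> * M \<in> H" "\<beta> * M \<in> H" if "M \<in> H" for M
    using that
    by (auto elim!: order_cases simp: alpha_quat_elt beta_quat_elt
        intro!: quat_elt_mem integers_closed parameters_integral)
  show ?thesis
    using assms(1)
  proof (rule order_cases)
    fix x y z w
    assume "L = quat_elt x y z w" "x \<in> R" "y \<in> R" "z \<in> R" "w \<in> R"
    then show "L * M \<in> H"
      using assms(2) by (simp add: quat_elt_mult order_add order_scaleR generators)
  qed
qed

lemma order_qcnj: "L \<in> H \<Longrightarrow> qcnj L \<in> H"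
  by (elim order_cases)
    (simp add: qcnj_quat_elt quat_elt_mem integers_closed parameters_integral)

lemma subring_order: "subring H ring_of_type_algebra"
  unfolding subring_ring_of_type_algebra_iff
proof (intro conjI ballI)
  show "0 \<in> H" "1 \<in> H"
    using quat_elt_mem[of 0 0 0 0] quat_elt_mem[of 1 0 0 0]
    by (simp_all add: integers_closed quat_elt_def)
  show "- L \<in> H" if "L \<in> H" for L
    using order_scaleR[of "- 1" L] that by (simp add: integers_closed)
qed (simp_all add: order_add order_mult)

lemma ring_order: "ring (subring_of H)"
  using ring_ring_of_type_algebra subring_order by (rule ring.subring_is_ring)

lemma qnorm_mem_integers: "L \<in> H \<Longrightarrow> qnorm L \<in> R"
  by (elim order_cases)
    (simp add: qnorm_quat_elt norm_form_def integers_closed parameters_integral)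

lemma conjugate_qnorm_pos:
  assumes t: "t \<in> {1..n}" and L: "L \<in> H" "L \<noteq> 0"
  shows "\<sigma> t (qnorm L) > 0"
proof -
  interpret subfield_embedding K "\<sigma> t" using t by (rule embedding)
  interpret conjugate: quat_parameters "\<sigma> t A" "\<sigma> t B" "\<sigma> t \<mu>" "\<sigma> t \<nu>"
    using t by (rule quat_parameters_conjugate)
  obtain x y z w where xyzw: "L = quat_elt x y z w" "x \<in> K" "y \<in> K" "z \<in> K" "w \<in> K"
    using L(1) by (elim order_cases) (blast intro: integers_mem_K)
  have "\<sigma> t (qnorm L) = norm_form (\<sigma> t A) (\<sigma> t B) (\<sigma> t \<mu>) (\<sigma> t \<nu>) (\<sigma> t x) (\<sigma> t y) (\<sigma> t z) (\<sigma> t w)"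
    using xyzw(2-5) parameters_mem_K
    by (simp add: xyzw(1) qnorm_quat_elt norm_form_def hom_add hom_mult hom_diff
        add_mem mult_mem diff_mem)
  then have "\<sigma> t (qnorm L) \<ge> 0"
    by (simp add: conjugate.norm_form_nonneg)
  moreover have "\<sigma> t (qnorm L) \<noteq> 0"
    using L by (simp add: hom_eq_0_iff integers_mem_K qnorm_mem_integers qnorm_eq_0_iff)
  ultimately show ?thesis by simp
qed

lemma double_norm_pos: "L \<in> H \<Longrightarrow> L \<noteq> 0 \<Longrightarrow> double_norm n \<sigma> L > 0"
  unfolding double_norm_def field_norm_def by (intro prod_pos conjugate_qnorm_pos)

lemma double_norm_Ints: "L \<in> H \<Longrightarrow> double_norm n \<sigma> L \<in> \<int>"
  by (simp add: double_norm_def field_norm_Ints qnorm_mem_integers)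

lemma double_norm_mult:
  assumes "L * M \<in> H" "M \<in> H" "M \<noteq> 0"
  shows "double_norm n \<sigma> (L * M) = double_norm n \<sigma> L * double_norm n \<sigma> M"
proof -
  have M: "qnorm M \<noteq> 0" "qnorm M \<in> K" and LM: "qnorm (L * M) \<in> K"
    using assms by (simp_all add: qnorm_eq_0_iff integers_mem_K qnorm_mem_integers)
  have "qnorm L = qnorm (L * M) * inverse (qnorm M)"
    using M(1) by (simp add: qnorm_mult)
  also have "\<dots> \<in> K"
    using LM M(2) by (intro mult_mem inverse_mem)
  finally show ?thesis
    using M(2) by (simp add: double_norm_def qnorm_mult field_norm_mult)
qed

lemma suitable_approximation:
  assumes "suitable n \<sigma> H \<rho>" "\<rho> \<noteq> 0" "\<rho> *\<^sub>R Y \<in> H" "Y \<notin> H"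
  obtains P Q where "P \<in> H" "Q \<in> H" "P * Y + Q \<noteq> 0" "double_norm n \<sigma> (P * Y + Q) < 1"
proof -
  have "\<rho> *\<^sub>R Y \<notin> {\<rho> *\<^sub>R M | M. M \<in> H}"
    using assms(2,4) by auto
  moreover have cancel: "\<rho> *\<^sub>R Y /\<^sub>R \<rho> = Y"
    using assms(2) by simp
  ultimately have "\<exists>L' \<in> {P * Y + Q | P Q. P \<in> H \<and> Q \<in> H}. L' \<noteq> 0 \<and> double_norm n \<sigma> L' < 1"
    using assms(1)[unfolded suitable_def, rule_format, OF assms(3)] unfolding cancel by blast
  then show thesis
    using that by blast
qed

end

locale suitable_quaternion_order = quaternion_order +
  assumes factorial: "factorial_domain (subring_of (ring_of_integers K))"
    and suitable: "\<And>\<rho>. \<rho> \<in> ring_of_integers K \<Longrightarrow>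
      ring_prime\<^bsub>subring_of (ring_of_integers K)\<^esub> \<rho> \<Longrightarrow> suitable n \<sigma> (quat_order K A B \<mu> \<nu>) \<rho>"
begin

lemma fraction_approximation:
  assumes d: "d \<in> R" "d \<noteq> 0" "d *\<^sub>R Y \<in> H" and Y: "Y \<notin> H"
  obtains P Q where "P \<in> H" "Q \<in> H" "P * Y + Q \<noteq> 0" "double_norm n \<sigma> (P * Y + Q) < 1"
proof -
  interpret factorial_domain "subring_of R" by (rule factorial)
  obtain \<rho> e where \<rho>: "\<rho> \<in> R" "ring_prime\<^bsub>subring_of R\<^esub> \<rho>"
    and e: "e \<in> R" "(\<rho> * e) *\<^sub>R Y \<in> H" "e *\<^sub>R Y \<notin> H"
  proof (rule prime_descent[of "{u. u *\<^sub>R Y \<in> H}" d])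
    show "u \<otimes>\<^bsub>subring_of R\<^esub> v \<in> {u. u *\<^sub>R Y \<in> H}"
      if "u \<in> carrier (subring_of R)" "v \<in> {u. u *\<^sub>R Y \<in> H}" for u v
      using that order_scaleR[of u "v *\<^sub>R Y"] by simp
  qed (use d Y in simp_all)
  have "\<rho> \<noteq> 0"
    using \<rho>(2) by (simp add: ring_prime_def)
  then obtain P Q where PQ: "P \<in> H" "Q \<in> H" "P * (e *\<^sub>R Y) + Q \<noteq> 0"
    "double_norm n \<sigma> (P * (e *\<^sub>R Y) + Q) < 1"
    using suitable_approximation[OF suitable[OF \<rho>], of "e *\<^sub>R Y"] e(2,3) by auto
  show thesis
    by (rule that[of "e *\<^sub>R P" Q]) (use PQ e(1) order_scaleR in simp_all)
qed

lemma double_norm_Dedekind_Hasse: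
  assumes "M \<in> H" "D \<in> H" "D \<noteq> 0" and not_multiple: "M \<notin> {L * D | L. L \<in> H}"
  obtains P Q where "P \<in> H" "Q \<in> H" "P * M + Q * D \<noteq> 0"
    "double_norm n \<sigma> (P * M + Q * D) < double_norm n \<sigma> D"
proof -
  define Y where "Y = M / D"
  have M: "Y * D = M"
    using assms(3) by (simp add: Y_def divide_inverse mult.assoc)
  have "qnorm D *\<^sub>R Y \<in> H"
    using assms(1-3) by (simp add: Y_def qnorm_scaleR_divide qnorm_eq_0_iff order_mult order_qcnj)
  moreover have "qnorm D \<in> R" "qnorm D \<noteq> 0"
    using assms(2,3) by (simp_all add: qnorm_mem_integers qnorm_eq_0_iff)
  moreover have "Y \<notin> H"
    using not_multiple M by blast
  ultimately obtain P Q where PQ: "P \<in> H" "Q \<in> H" "P * Y + Q \<noteq> 0"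
    and small: "double_norm n \<sigma> (P * Y + Q) < 1"
    using fraction_approximation by metis
  have combination: "(P * Y + Q) * D = P * M + Q * D"
    by (simp add: distrib_right mult.assoc M)
  also have "P * M + Q * D \<in> H"
    using PQ(1,2) assms(1,2) by (intro order_add order_mult)
  finally have "double_norm n \<sigma> ((P * Y + Q) * D) = double_norm n \<sigma> (P * Y + Q) * double_norm n \<sigma> D"
    using assms(2,3) by (rule double_norm_mult)
  also have "\<dots> < double_norm n \<sigma> D"
    using small double_norm_pos[OF assms(2,3)] by simp
  finally show thesis
    using that PQ(1-3) assms(3) combination by (metis no_zero_divisors)
qed

lemma left_ideal_principal:
  assumes "left_ideal I (subring_of H)"
  shows "\<exists>D\<in>H. I = PIdl\<^bsub>subring_of H\<^esub> D"
proof -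
  define N where "N L = nat \<lfloor>double_norm n \<sigma> L\<rfloor>" for L
  have N_less: "N L < N M"
    if LM: "L \<in> H" "M \<in> H" "M \<noteq> 0" and less: "double_norm n \<sigma> L < double_norm n \<sigma> M" for L M
  proof -
    obtain a b :: int where "double_norm n \<sigma> L = of_int a" "double_norm n \<sigma> M = of_int b"
      using LM(1,2)[THEN double_norm_Ints] by (auto elim!: Ints_cases)
    then show ?thesis
      using less double_norm_pos[OF LM(2,3)] by (simp add: N_def)
  qed
  have "\<exists>P\<in>H. \<exists>Q\<in>H. P * M + Q * D \<noteq> 0 \<and> N (P * M + Q * D) < N D"
    if MD: "M \<in> H" "D \<in> H" "D \<noteq> 0" and not_mem: "M \<notin> PIdl\<^bsub>subring_of H\<^esub> D" for M D
  proof -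
    have "M \<notin> {L * D | L. L \<in> H}"
      using not_mem by (simp add: cgenideal_def)
    then obtain P Q where PQ: "P \<in> H" "Q \<in> H" "P * M + Q * D \<noteq> 0"
      "double_norm n \<sigma> (P * M + Q * D) < double_norm n \<sigma> D"
      by (rule double_norm_Dedekind_Hasse[OF MD])
    have "P * M + Q * D \<in> H"
      using PQ(1,2) MD(1,2) by (intro order_add order_mult)
    then have "N (P * M + Q * D) < N D"
      using MD(2,3) PQ(4) by (rule N_less)
    then show ?thesis
      using PQ(1-3) by blast
  qed
  then show ?thesis
    using left_ideal_principal_if_Dedekind_Hasse[OF ring_order _ assms, of N] by simp
qed

end

theorem theorem5p1:
  fixes K :: "real set" and n :: nat and \<sigma> :: "nat \<Rightarrow> real \<Rightarrow> real"
    and A B \<mu> \<nu> :: real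
  assumes "number_field n K" and "totally_real K"
    and "bij_betw \<sigma> {1..n} (real_embeddings K)"
    and "\<forall>x\<in>K. \<sigma> 1 x = x"
    and "factorial_domain (subring_of (ring_of_integers K))"
    and "A \<in> ring_of_integers K" and "B \<in> ring_of_integers K"
    and "\<mu> \<in> ring_of_integers K" and "\<nu> \<in> ring_of_integers K"
    and "totally_positive n \<sigma> (disc_S A \<mu>)"
    and "totally_positive n \<sigma> (disc_T A B \<mu> \<nu>)"
    and "\<forall>\<rho>\<in>ring_of_integers K. ring_prime\<^bsub>subring_of (ring_of_integers K)\<^esub> \<rho> \<longrightarrow>
           suitable n \<sigma> (quat_order K A B \<mu> \<nu>) \<rho>"
  shows "left_principal_ideal_domain (subring_of (quat_order K A B \<mu> \<nu>))"
proof -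
  interpret suitable_quaternion_order K n \<sigma> A B \<mu> \<nu>
    by (intro suitable_quaternion_order.intro quaternion_order.intro number_field_embeddings.intro
        suitable_quaternion_order_axioms.intro quaternion_order_axioms.intro) (use assms in blast)+
  show ?thesis
    unfolding left_principal_ideal_domain_def
    using ring_order left_ideal_principal by simp
qed

end
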